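(* Let $K$ be a proper cone of $\mathbb{R}^n$, let $A\in\pi(K)$, and let $F$ be a face of $K$. The following conditions are equivalent: (a) $F$ is a distinguished $A$-invariant face of $K$. (b) $F$ is an $A$-invariant face, there is a unique (up to positive multiples) eigenvector of $A$ in $F$ that corresponds to $\rho_F$, and this eigenvector lies in $\operatorname{relint}F$. (c) $F=\Phi(x)$ for some extremal distinguished eigenvector $x$ of $A$. (d) $F$ is an $A$-invariant join-irreducible face of $K$ which contains in its relative interior an eigenvector of $A$.
   Context: A proper cone of $\mathbb{R}^n$ is a closed convex cone that is pointed ($K\cap(-K)=\{0\}$) and has nonempty interior. $\pi(K)$ is the set of real $n\times n$ matrices $A$ with $AK\subseteq K$. A face of $K$ is a convex subcone $F\subseteq K$ such that $x,y\in K$, $x+y\in F$ imply $x,y\in F$; it is $A$-invariant if $AF\subseteq F$. $\Phi(S)$ is the smallest face of $K$ including $S$, $\Phi(x)=\Phi(\{x\})$, and $F\vee G=\Phi(F\cup G)$. For an $A$-invariant face $F$, $\rho_F$ is the spectral radius of $A|_{\operatorname{span}F}$. A nonzero $A$-invariant face $F$ is a distinguished $A$-invariant face if $\rho_G<\rho_F$ for every nonzero $A$-invariant face $G$ properly included in $F$. An $A$-invariant face $F$ is $A$-invariant join-irreducible if it is not the join of two $A$-invariant faces of $K$ properly included in $F$. An extremal distinguished eigenvector of $A$ corresponding to $\lambda$ is a nonzero extreme vector of the cone $\mathcal{N}(\lambda I-A)\cap K$ ($\mathcal{N}$ denoting null space), i.e. a nonzero vector generating an extreme ray (one-dimensional face)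 of that cone. *)

theory Defs
  imports "HOL-Analysis.Analysis"
begin

definition proper_cone :: "'a::euclidean_space set \<Rightarrow> bool" where
  "proper_cone K \<longleftrightarrow>
     closed K \<and> convex_cone K \<and> K \<inter> uminus ` K = {0} \<and> interior K \<noteq> {}"

definition cone_preserving :: "(real^'n) set \<Rightarrow> (real^'n^'n) set" where
  "cone_preserving K = {A. (*v) A ` K \<subseteq> K}"

text \<open>Unlike the library's \<open>face_of\<close>, the predicate below never holds of the empty set,
  since \<^const>\<open>convex_cone\<close> requires nonemptiness; the least face is therefore \<open>{0}\<close> when
  \<open>K\<close> is pointed.\<close>

definition cone_face :: "'a::real_vector set \<Rightarrow> 'a set \<Rightarrow> bool" where
  "cone_face K F \<longleftrightarrow> convex_cone F \<and> F \<subseteq> K \<and>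
     (\<forall>x\<in>K. \<forall>y\<in>K. x + y \<in> F \<longrightarrow> x \<in> F \<and> y \<in> F)"

definition face_gen :: "'a::real_vector set \<Rightarrow> 'a set \<Rightarrow> 'a set" where
  "face_gen K S = cone_face K hull S"

definition face_join :: "'a::real_vector set \<Rightarrow> 'a set \<Rightarrow> 'a set \<Rightarrow> 'a set" where
  "face_join K F G = face_gen K (F \<union> G)"

lemma face_gen_least:
  assumes "convex_cone K" "S \<subseteq> K"
  shows "cone_face K (face_gen K S)" "S \<subseteq> face_gen K S"
    and "\<And>F. cone_face K F \<Longrightarrow> S \<subseteq> F \<Longrightarrow> face_gen K S \<subseteq> F"
proof -
  have "cone_face K K"
    using assms(1) by (auto simp: cone_face_def)
  then show "cone_face K (face_gen K S)"
    using assms(2) unfolding face_gen_def hull_def cone_face_def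
    by (auto intro!: convex_cone_Inter)
  show "S \<subseteq> face_gen K S"
    unfolding face_gen_def by (rule hull_subset)
  show "\<And>F. cone_face K F \<Longrightarrow> S \<subseteq> F \<Longrightarrow> face_gen K S \<subseteq> F"
    unfolding face_gen_def by (rule hull_minimal)
qed

definition invariant_face :: "(real^'n) set \<Rightarrow> real^'n^'n \<Rightarrow> (real^'n) set \<Rightarrow> bool" where
  "invariant_face K A F \<longleftrightarrow> cone_face K F \<and> (*v) A ` F \<subseteq> F"

text \<open>The complex eigenvalues of the restriction of \<open>A\<close> to an \<open>A\<close>-invariant real subspace
  \<open>V\<close>: eigenvectors are sought in the complexification of \<open>V\<close>, that is, among the complex
  vectors whose real and imaginary parts both lie in \<open>V\<close>.\<close>

definition eigenvalues_on :: "real^'n^'n \<Rightarrow> (real^'n) set \<Rightarrow> complex set" where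
  "eigenvalues_on A V =
     {\<mu>. \<exists>z::complex^'n. z \<noteq> 0 \<and> (\<chi> i. Re (z $ i)) \<in> V \<and> (\<chi> i. Im (z $ i)) \<in> V \<and>
        (\<chi> i j. complex_of_real (A $ i $ j)) *v z = \<mu> *s z}"

text \<open>The inserted \<open>0\<close> only matters for \<open>V = {0}\<close>, which has no eigenvalues and gets spectral
  radius \<open>0\<close>.\<close>

definition spectral_radius_on :: "real^'n^'n \<Rightarrow> (real^'n) set \<Rightarrow> real" where
  "spectral_radius_on A V = Max (insert 0 (cmod ` eigenvalues_on A V))"

definition face_radius :: "real^'n^'n \<Rightarrow> (real^'n) set \<Rightarrow> real" where
  "face_radius A F = spectral_radius_on A (span F)"

definition eigenvector :: "real^'n^'n \<Rightarrow> real \<Rightarrow> real^'n \<Rightarrow> bool" where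
  "eigenvector A \<mu> x \<longleftrightarrow> x \<noteq> 0 \<and> A *v x = \<mu> *\<^sub>R x"

definition distinguished_invariant_face ::
    "(real^'n) set \<Rightarrow> real^'n^'n \<Rightarrow> (real^'n) set \<Rightarrow> bool" where
  "distinguished_invariant_face K A F \<longleftrightarrow>
     invariant_face K A F \<and> F \<noteq> {0} \<and>
     (\<forall>G. invariant_face K A G \<and> G \<noteq> {0} \<and> G \<subset> F \<longrightarrow> face_radius A G < face_radius A F)"

definition invariant_join_irreducible ::
    "(real^'n) set \<Rightarrow> real^'n^'n \<Rightarrow> (real^'n) set \<Rightarrow> bool" where
  "invariant_join_irreducible K A F \<longleftrightarrow>
     invariant_face K A F \<and>
     \<not> (\<exists>G H. invariant_face K A G \<and> invariant_face K A H \<and> G \<subset> F \<and> H \<subset> F \<and>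
           F = face_join K G H)"

definition extreme_vector :: "'a::real_vector set \<Rightarrow> 'a \<Rightarrow> bool" where
  "extreme_vector C x \<longleftrightarrow> x \<in> C \<and> x \<noteq> 0 \<and> cone_face C {c *\<^sub>R x | c. 0 \<le> c}"

definition extremal_distinguished_eigenvector ::
    "(real^'n) set \<Rightarrow> real^'n^'n \<Rightarrow> real \<Rightarrow> real^'n \<Rightarrow> bool" where
  "extremal_distinguished_eigenvector K A \<mu> x \<longleftrightarrow>
     extreme_vector ({v. (\<mu> *\<^sub>R mat 1 - A) *v v = 0} \<inter> K) x"

end

(* On an invariant closed pointed cone F, a vector w in the relative interior with
   A w <= r w (in the order of F) bounds the spectral radius of A on span F by r. Brouwer's theorem,
   applied to the perturbed map x |-> A x + e g on a compact base of F, yields such vectors with r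
   arbitrarily close to the radius; letting e -> 0 gives a Perron eigenvector. Hence a relative
   interior eigenvector belongs to the radius of F, a distinguished face is generated by each of its
   Perron eigenvectors, and sums of such w show that the radius of a join of two invariant faces is
   the larger of their radii. *)

theory Submission
  imports Defs
begin

text \<open>The spectral radius speaks of complex eigenvalues, whereas a cone only sees real
  vectors. The bound by r is therefore proved on the real parts of all rotations of a complex
  eigenvector, and pointedness excludes an eigenvalue of modulus above r. Brouwer's map cannot be
  the normalised A alone, since A may kill points of the base. The perturbed vectors stay useful
  after the limit is taken: the Perron eigenvector may lie on the relative boundary, so for two
  proper faces these eigenvectors need not generate the join, while relative interior vectors do, at
  the price of an r strictly above both radii. Uniqueness rests on another device: from one
  eigenvector subtract as large a multiple of another, for the same eigenvalue, as F permits. The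
  result is zero or an eigenvector on the relative boundary. Condition (a) forbids the latter; (d)
  forbids that it happens in both directions at once.\<close>

section \<open>Order units, positive functionals and exits of rays in a cone\<close>

text \<open>The usual criterion prolongs the segment from y slightly past w; in a cone the end point
  may be rescaled, which turns it into domination of y by a multiple of w. This order-unit form
  matches the description of \<Phi>(x) below.\<close>

lemma cone_rel_interior_iff:
  fixes F :: "'a::euclidean_space set"
  assumes "convex_cone F"
  shows "w \<in> rel_interior F \<longleftrightarrow> w \<in> F \<and> (\<forall>y\<in>F. \<exists>\<alpha>>0. \<alpha> *\<^sub>R w - y \<in> F)"
proof
  have cv: "convex F" "F \<noteq> {}"
    using assms by (auto simp: convex_cone_def)
  show "w \<in> F \<and> (\<forall>y\<in>F. \<exists>\<alpha>>0. \<alpha> *\<^sub>R w - y \<in> F)" if w: "w \<in> rel_interior F"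
  proof (intro conjI ballI)
    show "w \<in> F"
      using w rel_interior_subset by blast
    fix y assume "y \<in> F"
    then obtain e where e: "e > 1" "(1 - e) *\<^sub>R y + e *\<^sub>R w \<in> F"
      using w convex_rel_interior_iff[OF cv] by blast
    have "(1 / (e - 1)) *\<^sub>R ((1 - e) *\<^sub>R y + e *\<^sub>R w) \<in> F"
      using e by (intro convex_cone_scaleR[OF assms]) auto
    also have "(1 / (e - 1)) *\<^sub>R ((1 - e) *\<^sub>R y + e *\<^sub>R w) = (e / (e - 1)) *\<^sub>R w - y"
    proof -
      have "(1 / (e - 1)) * (1 - e) = -1"
        using e by (simp add: field_simps)
      then have "(1 / (e - 1)) *\<^sub>R ((1 - e) *\<^sub>R y) = - y"
        by (metis scaleR_minus1_left scaleR_scaleR)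
      then show ?thesis
        by (simp add: scaleR_add_right)
    qed
    finally show "\<exists>\<alpha>>0. \<alpha> *\<^sub>R w - y \<in> F"
      using e by (intro exI[of _ "e / (e - 1)"]) auto
  qed
  show "w \<in> rel_interior F" if w: "w \<in> F \<and> (\<forall>y\<in>F. \<exists>\<alpha>>0. \<alpha> *\<^sub>R w - y \<in> F)"
    unfolding convex_rel_interior_iff[OF cv]
  proof
    fix y assume "y \<in> F"
    then obtain \<alpha> where a: "\<alpha> > 0" "\<alpha> *\<^sub>R w - y \<in> F"
      using w by blast
    have "(1 / \<alpha>) *\<^sub>R w + (1 / \<alpha>) *\<^sub>R (\<alpha> *\<^sub>R w - y) \<in> F"
      using a w by (intro convex_cone_add[OF assms] convex_cone_scaleR[OF assms]) auto
    also have "(1 / \<alpha>) *\<^sub>R w + (1 / \<alpha>) *\<^sub>R (\<alpha> *\<^sub>R w - y) = (1 - (1 + 1 / \<alpha>)) *\<^sub>R y + (1 + 1 / \<alpha>) *\<^sub>R w"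
      using a by (simp add: scaleR_diff_right scaleR_diff_left scaleR_add_left)
    finally show "\<exists>e>1. (1 - e) *\<^sub>R y + e *\<^sub>R w \<in> F"
      using a by (intro exI[of _ "1 + 1 / \<alpha>"]) auto
  qed
qed

lemma pointedD:
  assumes "F \<inter> uminus ` F = {0}" "x \<in> F" "- x \<in> F"
  shows "x = (0::'a::real_vector)"
proof -
  have "x \<in> uminus ` F"
    using assms(3) by (metis image_eqI minus_minus)
  then show ?thesis
    using assms(1,2) by blast
qed

text \<open>Pointedness makes \<open>F - {0}\<close> convex, so 0 is not in the convex hull of the
  unit vectors of F. That hull is compact and can be strictly separated from 0; homogeneity extends
  the estimate to all of F.\<close>

lemma pointed_cone_positive_functional:
  fixes F :: "'a::euclidean_space set"
  assumes "closed F" "convex_cone F" "F \<inter> uminus ` F = {0}"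
  obtains a b where "b > 0" "\<And>x. x \<in> F \<Longrightarrow> b * norm x \<le> a \<bullet> x"
proof -
  let ?S = "F \<inter> sphere 0 1"
  have "convex (F - {0})"
    unfolding convex_def
  proof (intro ballI allI impI)
    fix x y and u v :: real
    assume xy: "x \<in> F - {0}" "y \<in> F - {0}" and uv: "0 \<le> u" "0 \<le> v" "u + v = 1"
    have ux: "u *\<^sub>R x \<in> F" and vy: "v *\<^sub>R y \<in> F"
      using xy uv by (auto intro: convex_cone_scaleR[OF assms(2)])
    have "u *\<^sub>R x + v *\<^sub>R y \<noteq> 0"
    proof
      assume z: "u *\<^sub>R x + v *\<^sub>R y = 0"
      then have "v *\<^sub>R y = - (u *\<^sub>R x)"
        by (simp add: eq_neg_iff_add_eq_0 add.commute)
      then have "u *\<^sub>R x = 0"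
        using pointedD[OF assms(3) ux] vy by simp
      then show False
        using z xy uv by auto
    qed
    then show "u *\<^sub>R x + v *\<^sub>R y \<in> F - {0}"
      using convex_cone_add[OF assms(2) ux vy] by simp
  qed
  moreover have "?S \<subseteq> F - {0}"
    by auto
  ultimately have "0 \<notin> convex hull ?S"
    using hull_minimal[of ?S "F - {0}" convex] by blast
  moreover have "closed (convex hull ?S)"
    by (rule compact_imp_closed[OF compact_convex_hull[OF closed_Int_compact[OF assms(1) compact_sphere]]])
  ultimately obtain a b where ab: "0 < b" "\<And>x. x \<in> convex hull ?S \<Longrightarrow> b < a \<bullet> x"
    using separating_hyperplane_closed_0[OF convex_convex_hull] by metis
  have "b * norm x \<le> a \<bullet> x" if "x \<in> F" for x
  proof (cases "x = 0")
    case False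
    then have "(1 / norm x) *\<^sub>R x \<in> ?S"
      using that convex_cone_scaleR[OF assms(2), of "1 / norm x" x] by auto
    then have "b < a \<bullet> ((1 / norm x) *\<^sub>R x)"
      using ab(2) hull_inc by metis
    then show ?thesis
      using False by (simp add: field_simps)
  qed auto
  then show thesis
    using ab(1) that by blast
qed

text \<open>A largest t exists by compactness. At a relative interior point the ray could be
  followed further, because such a point still dominates y.\<close>

lemma ray_exit:
  fixes F :: "'a::euclidean_space set"
  assumes F: "closed F" "convex_cone F" "F \<inter> uminus ` F = {0}"
    and xy: "x \<in> F" "y \<in> F" "y \<noteq> 0"
  obtains t where "t \<ge> 0" "x - t *\<^sub>R y \<in> F" "x - t *\<^sub>R y \<notin> rel_interior F"
proof -
  obtain a b where ab: "b > 0" "\<And>x. x \<in> F \<Longrightarrow> b * norm x \<le> a \<bullet> x"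
    using pointed_cone_positive_functional[OF F] by blast
  have ay: "a \<bullet> y > 0"
    using ab xy by (meson less_le_trans mult_pos_pos zero_less_norm_iff)
  \<comment> \<open>The interval makes T compact; \<open>inT\<close> shows that it discards no
    admissible t, as a is nonnegative on F.\<close>
  define T where "T = {0..(a \<bullet> x) / (a \<bullet> y)} \<inter> (\<lambda>t. x - t *\<^sub>R y) -` F"
  have ge: "0 \<le> a \<bullet> z" if "z \<in> F" for z
    using ab(1) ab(2)[OF that] by (meson less_imp_le mult_nonneg_nonneg norm_ge_zero order_trans)
  have inT: "t \<in> T" if "t \<ge> 0" "x - t *\<^sub>R y \<in> F" for t
    using that ge[OF that(2)] ay by (auto simp: T_def inner_diff_right field_simps)
  have "compact T"
    unfolding T_def
    by (intro compact_Int_closed closed_vimage F continuous_intros) auto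
  moreover have "T \<noteq> {}"
    using inT[of 0] xy by auto
  ultimately obtain t where t: "t \<in> T" "\<And>s. s \<in> T \<Longrightarrow> s \<le> t"
    using compact_attains_sup[of T] by blast
  have t0: "t \<ge> 0" "x - t *\<^sub>R y \<in> F"
    using t(1) by (auto simp: T_def)
  have "x - t *\<^sub>R y \<notin> rel_interior F"
  proof
    assume "x - t *\<^sub>R y \<in> rel_interior F"
    then obtain \<alpha> where al: "\<alpha> > 0" "\<alpha> *\<^sub>R (x - t *\<^sub>R y) - y \<in> F"
      using cone_rel_interior_iff[OF F(2)] xy by blast
    have "(1 / \<alpha>) *\<^sub>R (\<alpha> *\<^sub>R (x - t *\<^sub>R y) - y) \<in> F"
      using al by (intro convex_cone_scaleR[OF F(2)]) auto
    also have "(1 / \<alpha>) *\<^sub>R (\<alpha> *\<^sub>R (x - t *\<^sub>R y) - y) = x - (t + 1 / \<alpha>) *\<^sub>R y"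
      using al by (simp add: algebra_simps)
    finally have "t + 1 / \<alpha> \<in> T"
      using t0 al by (intro inT) auto
    then show False
      using t(2) al by fastforce
  qed
  then show thesis
    using t0 that by blast
qed

section \<open>Faces of a cone and faces generated by one vector\<close>

text \<open>A point inside a segment is the sum of the two rescaled end points, so the additive
  notion of face implies \<open>face_of\<close>, for which closedness is known.\<close>

lemma cone_face_closed:
  fixes K :: "'a::euclidean_space set"
  assumes "closed K" "convex_cone K" "cone_face K F"
  shows "closed F"
proof (rule face_of_imp_closed[of K])
  show "convex K" "closed K"
    using assms by (auto simp: convex_cone_def)
  have F: "convex_cone F" "F \<subseteq> K" "\<And>x y. x \<in> K \<Longrightarrow> y \<in> K \<Longrightarrow> x + y \<in> F \<Longrightarrow> x \<in> F \<and> y \<in> F"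
    using assms(3) by (auto simp: cone_face_def)
  show "F face_of K"
    unfolding face_of_def
  proof (intro conjI ballI impI)
    show "F \<subseteq> K" "convex F"
      using F by (auto simp: convex_cone_def)
    fix a b x
    assume ab: "a \<in> K" "b \<in> K" "x \<in> F" "x \<in> open_segment a b"
    then obtain u where u: "0 < u" "u < 1" "x = (1 - u) *\<^sub>R a + u *\<^sub>R b"
      by (auto simp: in_segment)
    then have "(1 - u) *\<^sub>R a \<in> F" "u *\<^sub>R b \<in> F"
      using F(3)[of "(1 - u) *\<^sub>R a" "u *\<^sub>R b"] ab convex_cone_scaleR[OF assms(2)] by auto
    then have "(1 / (1 - u)) *\<^sub>R ((1 - u) *\<^sub>R a) \<in> F" "(1 / u) *\<^sub>R (u *\<^sub>R b) \<in> F"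
      using u by (auto simp del: scaleR_scaleR intro!: convex_cone_scaleR[OF F(1)])
    then show "a \<in> F" "b \<in> F"
      using u by auto
  qed
qed

lemma cone_face_pointed:
  assumes "K \<inter> uminus ` K = {0}" "cone_face K F"
  shows "F \<inter> uminus ` F = {0::'a::real_vector}"
proof -
  have "0 \<in> F" "F \<subseteq> K"
    using assms(2) convex_cone_contains_0 by (auto simp: cone_face_def)
  then show ?thesis
    using assms(1) by (auto simp: image_iff)
qed

lemma cone_face_mem_of_scaleR:
  assumes "cone_face K F" "c > 0" "c *\<^sub>R x \<in> F"
  shows "x \<in> F"
proof -
  have "(1 / c) *\<^sub>R (c *\<^sub>R x) \<in> F"
    using assms by (intro convex_cone_scaleR[OF _ _ assms(3)]) (auto simp: cone_face_def)
  then show ?thesis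
    using assms by simp
qed

text \<open>Domination by a multiple of x passes to summands, which makes the right-hand side a
  face. Conversely, a face containing x contains \<alpha> x = y + (\<alpha> x - y), hence y.\<close>

lemma face_gen_singleton:
  fixes K :: "'a::real_vector set"
  assumes K: "convex_cone K" and x: "x \<in> K"
  shows "face_gen K {x} = {y \<in> K. \<exists>\<alpha>>0. \<alpha> *\<^sub>R x - y \<in> K}" (is "_ = ?R")
proof
  have face: "cone_face K ?R"
    unfolding cone_face_def convex_cone_iff
  proof (intro conjI ballI allI impI)
    show "0 \<in> ?R"
      using x convex_cone_contains_0[OF K] by (auto intro!: exI[of _ 1])
    show "?R \<subseteq> K"
      by auto
  next
    fix y z assume "y \<in> ?R" "z \<in> ?R"
    then obtain \<alpha> \<beta> where h: "y \<in> K" "z \<in> K" "\<alpha> > 0" "\<beta> > 0" "\<alpha> *\<^sub>R x - y \<in> K" "\<beta> *\<^sub>R x - z \<in> K"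
      by auto
    have "(\<alpha> + \<beta>) *\<^sub>R x - (y + z) \<in> K"
      using convex_cone_add[OF K h(5,6)] by (simp add: algebra_simps)
    then show "y + z \<in> ?R"
      using h convex_cone_add[OF K h(1,2)] by (auto intro!: exI[of _ "\<alpha> + \<beta>"])
  next
    fix y and c :: real assume "y \<in> ?R" and c: "c \<ge> 0"
    then obtain \<alpha> where h: "y \<in> K" "\<alpha> > 0" "\<alpha> *\<^sub>R x - y \<in> K"
      by auto
    \<comment> \<open>The additional x keeps the coefficient \<open>1 + c * \<alpha>\<close>
      positive even for \<open>c = 0\<close>.\<close>
    have "x + c *\<^sub>R (\<alpha> *\<^sub>R x - y) \<in> K"
      using h c x by (intro convex_cone_add[OF K] convex_cone_scaleR[OF K])
    then have "(1 + c * \<alpha>) *\<^sub>R x - c *\<^sub>R y \<in> K"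
      by (simp add: algebra_simps)
    moreover have "1 + c * \<alpha> > 0"
      using c h by (simp add: add_pos_nonneg)
    ultimately show "c *\<^sub>R y \<in> ?R"
      using h c convex_cone_scaleR[OF K] by blast
  next
    fix y z assume h: "y \<in> K" "z \<in> K" "y + z \<in> ?R"
    then obtain \<alpha> where a: "\<alpha> > 0" "\<alpha> *\<^sub>R x - (y + z) \<in> K"
      by auto
    have "\<alpha> *\<^sub>R x - y \<in> K" "\<alpha> *\<^sub>R x - z \<in> K"
      using convex_cone_add[OF K a(2) h(1)] convex_cone_add[OF K a(2) h(2)]
      by (simp_all add: algebra_simps)
    then show "y \<in> ?R" "z \<in> ?R"
      using h a by auto
  qed
  moreover have "x \<in> ?R"
    using x convex_cone_contains_0[OF K] by (auto intro!: exI[of _ 1])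
  ultimately show "face_gen K {x} \<subseteq> ?R"
    using face_gen_least(3)[OF K, of "{x}"] x by simp
  show "?R \<subseteq> face_gen K {x}"
  proof
    fix y assume "y \<in> ?R"
    then obtain \<alpha> where h: "y \<in> K" "\<alpha> > 0" "\<alpha> *\<^sub>R x - y \<in> K"
      by auto
    have G: "cone_face K (face_gen K {x})" "x \<in> face_gen K {x}"
      using face_gen_least[OF K, of "{x}"] x by auto
    then have "y + (\<alpha> *\<^sub>R x - y) \<in> face_gen K {x}"
      using h convex_cone_scaleR[of "face_gen K {x}" \<alpha> x] by (auto simp: cone_face_def)
    then show "y \<in> face_gen K {x}"
      using G h unfolding cone_face_def by blast
  qed
qed

text \<open>If \<alpha> x dominates y in K, the difference is itself a summand of \<alpha> x and so
  belongs to the face; thus x is an order unit of the face and not merely relative to K.\<close>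

lemma rel_interior_face_gen_singleton:
  fixes K :: "'a::euclidean_space set"
  assumes K: "convex_cone K" and x: "x \<in> K"
  shows "x \<in> rel_interior (face_gen K {x})"
proof -
  have G: "cone_face K (face_gen K {x})" "x \<in> face_gen K {x}"
    using face_gen_least[OF K, of "{x}"] x by auto
  then have cc: "convex_cone (face_gen K {x})"
    by (simp add: cone_face_def)
  have "\<exists>\<alpha>>0. \<alpha> *\<^sub>R x - y \<in> face_gen K {x}" if y: "y \<in> face_gen K {x}" for y
  proof -
    obtain \<alpha> where h: "y \<in> K" "\<alpha> > 0" "\<alpha> *\<^sub>R x - y \<in> K"
      using y[unfolded face_gen_singleton[OF K x]] by blast
    have "y + (\<alpha> *\<^sub>R x - y) \<in> face_gen K {x}"
      using h G convex_cone_scaleR[OF cc, of \<alpha> x] by auto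
    then show ?thesis
      using G h unfolding cone_face_def by blast
  qed
  then show ?thesis
    using cone_rel_interior_iff[OF cc] G by blast
qed

lemma face_gen_rel_interior:
  fixes K :: "'a::euclidean_space set"
  assumes K: "convex_cone K" and F: "cone_face K F" and x: "x \<in> rel_interior F"
  shows "face_gen K {x} = F"
proof
  have cF: "convex_cone F" "F \<subseteq> K"
    using F by (auto simp: cone_face_def)
  have xF: "x \<in> F"
    using x rel_interior_subset by blast
  then show "face_gen K {x} \<subseteq> F"
    using face_gen_least(3)[OF K _ F, of "{x}"] cF by auto
  show "F \<subseteq> face_gen K {x}"
    using cone_rel_interior_iff[OF cF(1)] x face_gen_singleton[OF K, of x] xF cF(2) by blast
qed

section \<open>Finiteness of the set of eigenvalues\<close>

text \<open>Applying M to the relation and subtracting \<nu> times it removes the \<nu>-term and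
  multiplies each other coefficient by \<mu> - \<nu>, which is nonzero. Indexing the vectors by
  their eigenvalues builds in that these are distinct.\<close>

lemma independent_eigenvectors:
  fixes M :: "'a::field^'n^'n"
  assumes "finite T" "\<And>\<mu>. \<mu> \<in> T \<Longrightarrow> z \<mu> \<noteq> 0 \<and> M *v z \<mu> = \<mu> *s z \<mu>"
    and "(\<Sum>\<mu>\<in>T. c \<mu> *s z \<mu>) = 0" "\<mu> \<in> T"
  shows "c \<mu> = 0"
  using assms
proof (induction T arbitrary: c \<mu> rule: finite_induct)
  case (insert \<nu> T)
  have s: "c \<nu> *s z \<nu> + (\<Sum>\<mu>\<in>T. c \<mu> *s z \<mu>) = 0"
    using insert by simp
  have "M *v (c \<nu> *s z \<nu> + (\<Sum>\<mu>\<in>T. c \<mu> *s z \<mu>)) = 0"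
    using s by simp
  moreover have "M *v (c \<nu> *s z \<nu> + (\<Sum>\<mu>\<in>T. c \<mu> *s z \<mu>)) =
      (c \<nu> * \<nu>) *s z \<nu> + (\<Sum>\<mu>\<in>T. (c \<mu> * \<mu>) *s z \<mu>)"
  proof -
    have "M *v (\<Sum>\<mu>\<in>T. c \<mu> *s z \<mu>) = (\<Sum>\<mu>\<in>T. M *v (c \<mu> *s z \<mu>))"
      by (induction T rule: infinite_finite_induct) (auto simp: matrix_vector_right_distrib)
    also have "\<dots> = (\<Sum>\<mu>\<in>T. (c \<mu> * \<mu>) *s z \<mu>)"
      using insert.prems(1) by (intro sum.cong) (auto simp: matrix_vector_mult_scaleR vec.scale)
    finally show ?thesis
      using insert.prems(1) by (simp add: matrix_vector_right_distrib vec.scale)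
  qed
  ultimately have e1: "(c \<nu> * \<nu>) *s z \<nu> + (\<Sum>\<mu>\<in>T. (c \<mu> * \<mu>) *s z \<mu>) = 0"
    by simp
  have e2: "(c \<nu> * \<nu>) *s z \<nu> + (\<Sum>\<mu>\<in>T. (c \<mu> * \<nu>) *s z \<mu>) = 0"
  proof -
    have "\<nu> *s (c \<nu> *s z \<nu> + (\<Sum>\<mu>\<in>T. c \<mu> *s z \<mu>)) = 0"
      using s by simp
    then show ?thesis
      by (simp add: vec.scale_right_distrib vec.scale_sum_right mult.commute)
  qed
  have "(\<Sum>\<mu>\<in>T. (c \<mu> * (\<mu> - \<nu>)) *s z \<mu>) = 0"
  proof -
    have "(\<Sum>\<mu>\<in>T. (c \<mu> * (\<mu> - \<nu>)) *s z \<mu>) =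
        (\<Sum>\<mu>\<in>T. (c \<mu> * \<mu>) *s z \<mu>) - (\<Sum>\<mu>\<in>T. (c \<mu> * \<nu>) *s z \<mu>)"
      by (simp add: sum_subtractf[symmetric] vec.scale_left_diff_distrib right_diff_distrib)
    then show ?thesis
      using add_left_imp_eq[OF trans[OF e1 e2[symmetric]]] by simp
  qed
  then have zero: "c \<mu> = 0" if "\<mu> \<in> T" for \<mu>
    using insert.IH[of "\<lambda>\<mu>. c \<mu> * (\<mu> - \<nu>)" \<mu>] insert.prems(1) insert.hyps that by auto
  then have "c \<nu> *s z \<nu> = 0"
    using s by simp
  then have "c \<nu> = 0"
    using insert.prems(1)[of \<nu>] by simp
  then show ?case
    using zero insert.prems by auto
qed simp

text \<open>One eigenvector chosen per eigenvalue gives an independent family, which is finite in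
  finite dimension. Without finiteness the \<open>Max\<close> in \<open>spectral_radius_on\<close>
  would say nothing.\<close>

lemma finite_eigenvalues:
  fixes M :: "'a::field^'n^'n"
  shows "finite {\<mu>. \<exists>z. z \<noteq> 0 \<and> M *v z = \<mu> *s z}"
proof -
  define E where "E = {\<mu>. \<exists>z. z \<noteq> 0 \<and> M *v z = \<mu> *s z}"
  have "\<forall>\<mu>\<in>E. \<exists>z. z \<noteq> 0 \<and> M *v z = \<mu> *s z"
    by (simp add: E_def)
  then have "\<exists>z. \<forall>\<mu>\<in>E. z \<mu> \<noteq> 0 \<and> M *v z \<mu> = \<mu> *s z \<mu>"
    by (rule bchoice)
  then obtain z where "\<forall>\<mu>\<in>E. z \<mu> \<noteq> 0 \<and> M *v z \<mu> = \<mu> *s z \<mu>" ..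
  then have z: "z \<mu> \<noteq> 0 \<and> M *v z \<mu> = \<mu> *s z \<mu>" if "\<mu> \<in> E" for \<mu>
    using that by (rule bspec)
  have inj: "inj_on z E"
  proof (rule inj_onI)
    fix \<mu> \<nu> assume h: "\<mu> \<in> E" "\<nu> \<in> E" "z \<mu> = z \<nu>"
    then have "\<mu> *s z \<mu> = \<nu> *s z \<mu>"
      using z[OF h(1)] z[OF h(2)] by metis
    then have "(\<mu> - \<nu>) *s z \<mu> = 0"
      by (simp add: vec.scale_left_diff_distrib)
    then show "\<mu> = \<nu>"
      using z[OF h(1)] by simp
  qed
  have "vec.independent (z ` E)"
    unfolding vec.independent_explicit_module
  proof (intro allI impI)
    fix S u v
    assume S: "finite S" "S \<subseteq> z ` E" "(\<Sum>v\<in>S. u v *s v) = 0" "v \<in> S"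
    then obtain T where T: "T \<subseteq> E" "S = z ` T"
      by (auto simp: subset_image_iff)
    have iT: "inj_on z T"
      using inj_on_subset[OF inj T(1)] .
    have "finite T"
      using S(1) unfolding T(2) finite_image_iff[OF iT] .
    moreover have "(\<Sum>\<mu>\<in>T. u (z \<mu>) *s z \<mu>) = 0"
      using S(3) T iT by (simp add: sum.reindex)
    moreover obtain \<mu> where mu: "\<mu> \<in> T" "v = z \<mu>"
      using S(4) T(2) by blast
    ultimately have "u (z \<mu>) = 0"
      using independent_eigenvectors[of T z M "\<lambda>\<mu>. u (z \<mu>)", OF _ z[OF subsetD[OF T(1)]]] mu(1)
      by blast
    then show "u v = 0"
      using mu(2) by simp
  qed
  then have "finite (z ` E)"
    by (rule vec.finiteI_independent)
  then show ?thesis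
    using finite_image_iff[OF inj] by (simp add: E_def)
qed

lemma finite_eigenvalues_on: "finite (eigenvalues_on A V)"
  by (rule finite_subset[OF _ finite_eigenvalues]) (auto simp: eigenvalues_on_def)

section \<open>The spectral radius on an invariant cone: bounds and Perron eigenvectors\<close>

lemma spectral_radius_on_le_iff:
  "spectral_radius_on A V \<le> r \<longleftrightarrow> 0 \<le> r \<and> (\<forall>\<mu>\<in>eigenvalues_on A V. cmod \<mu> \<le> r)"
  unfolding spectral_radius_on_def using finite_eigenvalues_on[of A V] by auto

text \<open>The real eigenvector is read as a complex one with zero imaginary part.\<close>

lemma eigenvalue_le_face_radius:
  fixes A :: "real^'n^'n"
  assumes "eigenvector A \<mu> x" "x \<in> F"
  shows "\<bar>\<mu>\<bar> \<le> face_radius A F"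
proof -
  define z :: "complex^'n" where "z = (\<chi> i. complex_of_real (x $ i))"
  have "z \<noteq> 0"
    using assms(1) by (auto simp: z_def eigenvector_def vec_eq_iff)
  moreover have "(\<chi> i. Re (z $ i)) \<in> span F" "(\<chi> i. Im (z $ i)) \<in> span F"
    using assms(2) span_zero[of F] by (auto simp: z_def span_base zero_vec_def)
  moreover have "(\<chi> i j. complex_of_real (A $ i $ j)) *v z = complex_of_real \<mu> *s z"
    using assms(1)
    by (auto simp: z_def eigenvector_def vec_eq_iff matrix_vector_mult_def
        simp flip: of_real_mult of_real_sum)
  ultimately have "complex_of_real \<mu> \<in> eigenvalues_on A (span F)"
    unfolding eigenvalues_on_def by blast
  then show ?thesis
    using spectral_radius_on_le_iff[of A "span F" "face_radius A F"]
    by (auto simp: face_radius_def)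
qed

text \<open>Let z be a complex eigenvector for \<mu> and \<open>U c\<close> the real part of c z, so
  that A maps \<open>U c\<close> to \<open>U (c * \<mu>)\<close>. If every \<open>U c\<close> with c
  of modulus 1 is dominated by s w, then applying A, using A w \<le> r w and dividing by
  \<open>cmod \<mu>\<close> improves s by the factor \<open>r / cmod \<mu>\<close>. If that is below
  1, iteration gives \<open>U c\<close> \<le> 0 for every phase c, and pointedness yields z =
  0.\<close>

lemma face_radius_le:
  fixes A :: "real^'n^'n"
  assumes F: "closed F" "convex_cone F" "F \<inter> uminus ` F = {0}"
    and AF: "(*v) A ` F \<subseteq> F"
    and w: "w \<in> rel_interior F" "r *\<^sub>R w - A *v w \<in> F" and r: "r \<ge> 0"
  shows "face_radius A F \<le> r"
  unfolding face_radius_def spectral_radius_on_le_iff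
proof (intro conjI ballI r)
  fix \<mu> assume "\<mu> \<in> eigenvalues_on A (span F)"
  then obtain z :: "complex^'n" where z: "z \<noteq> 0"
      "(\<chi> i. Re (z $ i)) \<in> span F" "(\<chi> i. Im (z $ i)) \<in> span F"
      "(\<chi> i j. complex_of_real (A $ i $ j)) *v z = \<mu> *s z"
    by (auto simp: eigenvalues_on_def)
  define U where "U c = (\<chi> i. Re (c * z $ i))" for c
  have U_eq: "U c = Re c *\<^sub>R (\<chi> i. Re (z $ i)) - Im c *\<^sub>R (\<chi> i. Im (z $ i))" for c
    by (simp add: U_def vec_eq_iff)
  have U_span: "U c \<in> span F" for c
    unfolding U_eq using z by (intro span_diff span_scale)
  have U_scale: "U (of_real a * c) = a *\<^sub>R U c" for a c
    by (simp add: U_def vec_eq_iff algebra_simps)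
  have AU: "A *v U c = U (c * \<mu>)" for c
  proof -
    have "(A *v U c) $ i = U (c * \<mu>) $ i" for i
    proof -
      have "(A *v U c) $ i = (\<Sum>j\<in>UNIV. Re (c * (complex_of_real (A $ i $ j) * z $ j)))"
        by (auto simp: matrix_vector_mult_def U_def algebra_simps intro!: sum.cong)
      also have "\<dots> = Re (c * (\<Sum>j\<in>UNIV. complex_of_real (A $ i $ j) * z $ j))"
        by (simp add: sum_distrib_left)
      also have "(\<Sum>j\<in>UNIV. complex_of_real (A $ i $ j) * z $ j) =
          ((\<chi> i j. complex_of_real (A $ i $ j)) *v z) $ i"
        by (simp add: matrix_vector_mult_def)
      finally show ?thesis
        by (simp add: z(4) U_def mult.assoc)
    qed
    then show ?thesis
      by (simp add: vec_eq_iff)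
  qed
  have wF: "w \<in> F"
    using w rel_interior_subset by blast
  show "cmod \<mu> \<le> r"
  proof (rule ccontr)
    assume "\<not> cmod \<mu> \<le> r"
    then have mu: "cmod \<mu> > r" "cmod \<mu> > 0"
      using r by auto
    define q where "q = r / cmod \<mu>"
    have q: "0 \<le> q" "q < 1"
      using mu r by (auto simp: q_def)
    \<comment> \<open>Near w the span of F lies in F, because \<open>affine hull F\<close> is the
      span when \<open>0 \<in> F\<close>. A common bound B for all \<open>U c\<close> makes one t
      serve every phase; the summand 1 in B keeps it positive.\<close>
    obtain t where t: "t \<ge> 0" "\<And>c. cmod c = 1 \<Longrightarrow> t *\<^sub>R w - U c \<in> F"
    proof -
      obtain e where e: "e > 0" "ball w e \<inter> affine hull F \<subseteq> F"
        using w(1) by (auto simp: mem_rel_interior_ball)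
      define B where "B = norm (\<chi> i. Re (z $ i)) + norm (\<chi> i. Im (z $ i)) + 1"
      have B: "B > 0"
        unfolding B_def by (smt (verit) norm_ge_zero)
      have UB: "norm (U c) < B" if "cmod c = 1" for c
      proof -
        have "norm (U c) \<le> \<bar>Re c\<bar> * norm (\<chi> i. Re (z $ i)) + \<bar>Im c\<bar> * norm (\<chi> i. Im (z $ i))"
          unfolding U_eq by (metis norm_triangle_ineq4 norm_scaleR)
        also have "\<dots> \<le> 1 * norm (\<chi> i. Re (z $ i)) + 1 * norm (\<chi> i. Im (z $ i))"
          using that abs_Re_le_cmod[of c] abs_Im_le_cmod[of c]
          by (intro add_mono mult_right_mono) auto
        finally show ?thesis
          by (simp add: B_def)
      qed
      have "(B / e) *\<^sub>R w - U c \<in> F" if c: "cmod c = 1" for c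
      proof -
        have "norm ((e / B) *\<^sub>R U c) < e"
          using UB[OF c] e(1) B by (simp add: field_simps)
        moreover have "w - (e / B) *\<^sub>R U c \<in> span F"
          by (rule span_diff[OF span_base[OF wF] span_scale[OF U_span]])
        ultimately have "w - (e / B) *\<^sub>R U c \<in> F"
          using e(2) affine_hull_span_0[of F] hull_inc[OF convex_cone_contains_0[OF F(2)]]
          by (auto simp: dist_norm)
        then have "(B / e) *\<^sub>R (w - (e / B) *\<^sub>R U c) \<in> F"
          using e(1) B by (intro convex_cone_scaleR[OF F(2)]) auto
        then show ?thesis
          using e(1) B by (simp add: algebra_simps)
      qed
      then show thesis
        using that[of "B / e"] e(1) B by auto
    qed
    have iter: "(t * q ^ n) *\<^sub>R w - U c \<in> F" if "cmod c = 1" for n c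
      using that
    proof (induction n arbitrary: c)
      case (Suc n)
      define s where "s = t * q ^ n"
      \<comment> \<open>The phase c' undoes the rotation by \<mu>, so that A sends
        \<open>U c'\<close> to a positive multiple of \<open>U c\<close>.\<close>
      define c' where "c' = c * (of_real (cmod \<mu>) / \<mu>)"
      have "cmod c' = 1"
        using Suc.prems mu by (simp add: c'_def norm_mult norm_divide)
      then have "s *\<^sub>R w - U c' \<in> F"
        using Suc.IH by (simp add: s_def)
      then have "A *v (s *\<^sub>R w - U c') \<in> F"
        using AF by blast
      moreover have "s *\<^sub>R (r *\<^sub>R w - A *v w) \<in> F"
        using w q t by (intro convex_cone_scaleR[OF F(2)]) (auto simp: s_def)
      ultimately have "A *v (s *\<^sub>R w - U c') + s *\<^sub>R (r *\<^sub>R w - A *v w) \<in> F"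
        by (rule convex_cone_add[OF F(2)])
      moreover have "A *v U c' = cmod \<mu> *\<^sub>R U c"
      proof -
        have "c' * \<mu> = of_real (cmod \<mu>) * c"
          using mu by (auto simp: c'_def)
        then show ?thesis
          by (simp add: AU U_scale)
      qed
      ultimately have "(s * r) *\<^sub>R w - cmod \<mu> *\<^sub>R U c \<in> F"
        by (simp add: matrix_vector_mult_diff_distrib matrix_vector_mult_scaleR algebra_simps)
      then have "(1 / cmod \<mu>) *\<^sub>R ((s * r) *\<^sub>R w - cmod \<mu> *\<^sub>R U c) \<in> F"
        using mu by (intro convex_cone_scaleR[OF F(2)]) auto
      then show ?case
        using mu by (simp add: algebra_simps s_def q_def)
    qed (use t in auto)
    have neg: "- U c \<in> F" if c: "cmod c = 1" for c
    proof (rule closed_sequentially[OF F(1)])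
      show "(t * q ^ n) *\<^sub>R w - U c \<in> F" for n
        using iter c by blast
      have "(\<lambda>n. (t * q ^ n) *\<^sub>R w - U c) \<longlonglongrightarrow> (t * 0) *\<^sub>R w - U c"
        using q by (intro tendsto_intros LIMSEQ_realpow_zero)
      then show "(\<lambda>n. (t * q ^ n) *\<^sub>R w - U c) \<longlonglongrightarrow> - U c"
        by simp
    qed
    have "U c = 0" if c: "cmod c = 1" for c
    proof (rule pointedD[OF F(3)])
      show "- U c \<in> F"
        using neg c by blast
      have "- U (- c) \<in> F"
        using neg[of "- c"] c by simp
      then show "U c \<in> F"
        using U_scale[of "-1" c] by simp
    qed
    \<comment> \<open>These are the real and the imaginary part of z.\<close>
    then have "U 1 = 0" "U (- \<i>) = 0"
      by auto
    then have "z = 0"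
      by (simp add: U_def vec_eq_iff complex_eq_iff)
    then show False
      using z by blast
  qed
qed

text \<open>The vector x bounds the radius from both sides: as an eigenvector from below, and as a
  relative interior vector with \<mu> x - A x = 0 from above. A negative \<mu> would put both \<mu>
  x and its negative into F.\<close>

lemma face_radius_eigenvector:
  fixes A :: "real^'n^'n"
  assumes F: "closed F" "convex_cone F" "F \<inter> uminus ` F = {0}"
    and AF: "(*v) A ` F \<subseteq> F"
    and x: "x \<in> rel_interior F" "eigenvector A \<mu> x"
  shows "face_radius A F = \<mu>"
proof -
  have xF: "x \<in> F"
    using x rel_interior_subset by blast
  have "\<mu> \<ge> 0"
  proof (rule ccontr)
    assume "\<not> \<mu> \<ge> 0"
    then have "(- \<mu>) *\<^sub>R x \<in> F"
      using xF by (intro convex_cone_scaleR[OF F(2)]) auto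
    moreover have "\<mu> *\<^sub>R x \<in> F"
      using AF xF x by (auto simp: eigenvector_def)
    ultimately have "\<mu> *\<^sub>R x = 0"
      using pointedD[OF F(3), of "\<mu> *\<^sub>R x"] by simp
    then show False
      using x \<open>\<not> \<mu> \<ge> 0\<close> by (auto simp: eigenvector_def)
  qed
  moreover have "face_radius A F \<le> \<mu>"
    using x \<open>\<mu> \<ge> 0\<close> convex_cone_contains_0[OF F(2)]
    by (intro face_radius_le[OF F AF x(1)]) (auto simp: eigenvector_def)
  ultimately show ?thesis
    using eigenvalue_le_face_radius[OF x(2) xF] by simp
qed

text \<open>Brouwer's theorem on the base \<open>{x \<in> F. a \<bullet> x = 1}\<close>; the added \<open>e *\<^sub>R g\<close> keeps the
  normalisation away from division by \<open>0\<close> and pushes the fixed point into the relative interior.\<close>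

lemma perturbed_eigenvector:
  fixes A :: "real^'n^'n"
  assumes F: "closed F" "convex_cone F" and AF: "(*v) A ` F \<subseteq> F"
    and ab: "b > 0" "\<And>x. x \<in> F \<Longrightarrow> b * norm x \<le> a \<bullet> x"
    and g: "g \<in> rel_interior F" "g \<noteq> 0" and e: "e > 0"
  obtains x l where "x \<in> rel_interior F" "a \<bullet> x = 1" "l > 0" "A *v x + e *\<^sub>R g = l *\<^sub>R x"
proof -
  have gF: "g \<in> F"
    using g rel_interior_subset by blast
  have pos: "a \<bullet> x > 0" if "x \<in> F" "x \<noteq> 0" for x
    using ab that by (meson less_le_trans mult_pos_pos zero_less_norm_iff)
  have nn: "a \<bullet> x \<ge> 0" if "x \<in> F" for x
    using pos[OF that] by (cases "x = 0") auto
  define B where "B = F \<inter> {x. a \<bullet> x = 1}"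
  define h where "h x = A *v x + e *\<^sub>R g" for x
  define f where "f x = (1 / (a \<bullet> h x)) *\<^sub>R h x" for x
  have hF: "h x \<in> F" if "x \<in> F" for x
    using that AF e gF unfolding h_def
    by (intro convex_cone_add[OF F(2)] convex_cone_scaleR[OF F(2)]) auto
  have hpos: "a \<bullet> h x > 0" if "x \<in> F" for x
  proof -
    have "a \<bullet> (A *v x) \<ge> 0"
      using AF that by (intro nn) auto
    moreover have "e * (a \<bullet> g) > 0"
      using e pos[OF gF g(2)] by simp
    ultimately show ?thesis
      by (simp add: h_def inner_add_right)
  qed
  have "compact B"
  proof -
    have "closed B"
      unfolding B_def using F(1) by (intro closed_Int closed_hyperplane) auto
    moreover have "norm x \<le> 1 / b" if "x \<in> B" for x
      using ab(2)[of x] that ab(1) by (auto simp: B_def field_simps)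
    ultimately show ?thesis
      using compact_eq_bounded_closed bounded_iff by blast
  qed
  moreover have "convex B"
    unfolding B_def using F(2)
    by (intro convex_Int convex_hyperplane) (auto simp: convex_cone_def)
  moreover have "(1 / (a \<bullet> g)) *\<^sub>R g \<in> B"
    using pos[OF gF g(2)] gF by (auto simp: B_def intro!: convex_cone_scaleR[OF F(2)])
  then have "B \<noteq> {}"
    by blast
  moreover have "continuous_on B f"
  proof -
    have "continuous_on B h"
      unfolding h_def by (intro continuous_intros matrix_vector_mult_linear_continuous_on)
    then show ?thesis
      unfolding f_def using hpos by (intro continuous_intros) (force simp: B_def)+
  qed
  moreover have "f \<in> B \<rightarrow> B"
  proof
    fix x assume "x \<in> B"
    then have "x \<in> F"
      by (simp add: B_def)
    then have hx: "h x \<in> F" "a \<bullet> h x > 0"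
      using hF hpos by auto
    then have "f x \<in> F"
      unfolding f_def by (intro convex_cone_scaleR[OF F(2)]) auto
    moreover have "a \<bullet> f x = 1"
      using hx by (simp add: f_def)
    ultimately show "f x \<in> B"
      by (simp add: B_def)
  qed
  ultimately obtain x where x: "x \<in> B" "f x = x"
    using brouwer by blast
  define l where "l = a \<bullet> h x"
  have xF: "x \<in> F" "a \<bullet> x = 1"
    using x by (auto simp: B_def)
  have l: "l > 0"
    using hpos xF by (simp add: l_def)
  have "l *\<^sub>R f x = h x"
    using l by (simp add: f_def flip: l_def)
  then have eq: "h x = l *\<^sub>R x"
    using x by simp
  have "x \<in> rel_interior F"
    unfolding cone_rel_interior_iff[OF F(2)]
  proof (intro conjI ballI xF)
    fix y assume "y \<in> F"
    then obtain \<alpha> where al: "\<alpha> > 0" "\<alpha> *\<^sub>R g - y \<in> F"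
      using g cone_rel_interior_iff[OF F(2)] by blast
    \<comment> \<open>Since l x = A x + e g dominates e g, multiplying by \<alpha> / e carries the
      order-unit property of g over to x.\<close>
    have "(\<alpha> / e) *\<^sub>R (A *v x) + (\<alpha> *\<^sub>R g - y) \<in> F"
      using al e xF AF by (intro convex_cone_add[OF F(2)] convex_cone_scaleR[OF F(2)]) auto
    moreover have "(\<alpha> / e * l) *\<^sub>R x - y = (\<alpha> / e) *\<^sub>R (A *v x) + (\<alpha> *\<^sub>R g - y)"
    proof -
      have "(\<alpha> / e * l) *\<^sub>R x = (\<alpha> / e) *\<^sub>R h x"
        by (simp add: eq)
      then show ?thesis
        using e by (simp add: h_def algebra_simps)
    qed
    ultimately show "\<exists>\<alpha>>0. \<alpha> *\<^sub>R x - y \<in> F"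
      using al e l by (intro exI[of _ "\<alpha> / e * l"]) (auto simp: add_diff_eq)
  qed
  then show thesis
    using that xF l eq by (simp add: h_def)
qed

text \<open>The limit is squeezed: every \<open>L n\<close> is at least the radius because
  \<open>X n\<close> is a supersolution in the relative interior, while the limit of a subsequence
  is an eigenvalue and so at most the radius. Hence some \<open>L n\<close> drops below any r above
  the radius, and \<open>X n\<close> serves as w.\<close>

lemma perron_frobenius:
  fixes A :: "real^'n^'n"
  assumes F: "closed F" "convex_cone F" "F \<inter> uminus ` F = {0}" and F0: "F \<noteq> {0}"
    and AF: "(*v) A ` F \<subseteq> F"
  shows "\<exists>x\<in>F. eigenvector A (face_radius A F) x"
    and "r > face_radius A F \<Longrightarrow> \<exists>w\<in>rel_interior F. r *\<^sub>R w - A *v w \<in> F"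
proof -
  obtain a b where ab: "b > 0" "\<And>x. x \<in> F \<Longrightarrow> b * norm x \<le> a \<bullet> x"
    using pointed_cone_positive_functional[OF F] by blast
  have cv: "convex F" "F \<noteq> {}"
    using F(2) by (auto simp: convex_cone_def)
  obtain g where g: "g \<in> rel_interior F"
    using rel_interior_eq_empty[OF cv(1)] cv(2) by blast
  have g0: "g \<noteq> 0"
  proof
    assume "g = 0"
    then have "- y \<in> F" if "y \<in> F" for y
      using g cone_rel_interior_iff[OF F(2)] that by auto
    then have "F \<subseteq> {0}"
      using pointedD[OF F(3)] by blast
    then show False
      using F0 cv by blast
  qed
  have gF: "g \<in> F"
    using g rel_interior_subset by blast
  define e where "e n = 1 / real (Suc n)" for n
  have e_pos: "e n > 0" for n
    by (simp add: e_def)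
  have "\<forall>n. \<exists>x l. x \<in> rel_interior F \<and> a \<bullet> x = 1 \<and> l > 0 \<and> A *v x + e n *\<^sub>R g = l *\<^sub>R x"
    using perturbed_eigenvector[OF F(1,2) AF ab g g0 e_pos] by metis
  then obtain X L where XL: "\<And>n. X n \<in> rel_interior F" "\<And>n. a \<bullet> X n = 1" "\<And>n. L n > 0"
      "\<And>n. A *v X n + e n *\<^sub>R g = L n *\<^sub>R X n"
    by metis
  have XF: "X n \<in> F" for n
    using XL(1) rel_interior_subset by blast
  have rad: "face_radius A F \<le> L n" for n
  proof (rule face_radius_le[OF F AF XL(1)])
    have "L n *\<^sub>R X n - A *v X n = e n *\<^sub>R g"
      using XL(4)[of n] by (simp add: algebra_simps)
    then show "L n *\<^sub>R X n - A *v X n \<in> F"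
      using convex_cone_scaleR[OF F(2) _ gF] e_pos[of n] by simp
  qed (use XL(3)[of n] in simp)
  have "bounded (range X)"
  proof -
    have "norm (X n) \<le> 1 / b" for n
      using ab(2)[OF XF[of n]] ab(1) XL(2)[of n] by (simp add: field_simps)
    then show ?thesis
      by (auto simp: bounded_iff)
  qed
  then obtain x s where xs: "strict_mono (s::nat \<Rightarrow> nat)" "(X \<circ> s) \<longlonglongrightarrow> x"
    using bounded_imp_convergent_subsequence by blast
  \<comment> \<open>The normalisation survives the limit and is what keeps x nonzero.\<close>
  have ax: "a \<bullet> x = 1"
  proof -
    have "(\<lambda>n. a \<bullet> (X \<circ> s) n) \<longlonglongrightarrow> a \<bullet> x"
      by (intro tendsto_intros xs)
    then show ?thesis
      using XL(2) LIMSEQ_unique[OF _ tendsto_const] by fastforce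
  qed
  have xF: "x \<in> F"
    using closed_sequentially[OF F(1), of "X \<circ> s" x] XF xs by auto
  have "e \<longlonglongrightarrow> 0"
    unfolding e_def using LIMSEQ_inverse_real_of_nat by (simp add: inverse_eq_divide)
  then have es: "(e \<circ> s) \<longlonglongrightarrow> 0"
    using LIMSEQ_subseq_LIMSEQ xs(1) by blast
  have AX: "(\<lambda>n. A *v (X \<circ> s) n + (e \<circ> s) n *\<^sub>R g) \<longlonglongrightarrow> A *v x + 0 *\<^sub>R g"
    by (intro tendsto_intros es bounded_linear.tendsto[OF matrix_vector_mul_bounded_linear] xs(2))
  define l where "l = a \<bullet> (A *v x)"
  have Ls: "(L \<circ> s) \<longlonglongrightarrow> l"
  proof -
    have "L n = a \<bullet> (A *v X n + e n *\<^sub>R g)" for n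
      using XL(2)[of n] by (simp add: XL(4))
    moreover have "(\<lambda>n. a \<bullet> (A *v (X \<circ> s) n + (e \<circ> s) n *\<^sub>R g)) \<longlonglongrightarrow> a \<bullet> (A *v x + 0 *\<^sub>R g)"
      by (intro tendsto_intros AX)
    ultimately show ?thesis
      by (simp add: l_def o_def)
  qed
  have "A *v x = l *\<^sub>R x"
  proof -
    have "(\<lambda>n. (L \<circ> s) n *\<^sub>R (X \<circ> s) n) \<longlonglongrightarrow> l *\<^sub>R x"
      by (intro tendsto_intros Ls xs)
    then show ?thesis
      using LIMSEQ_unique AX XL(4) by (simp add: o_def)
  qed
  then have ev: "eigenvector A l x"
    using ax by (auto simp: eigenvector_def)
  have "face_radius A F \<le> l"
    using LIMSEQ_le_const[OF Ls, of "face_radius A F"] rad by auto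
  then have l: "l = face_radius A F"
    using eigenvalue_le_face_radius[OF ev xF] by simp
  show "\<exists>x\<in>F. eigenvector A (face_radius A F) x"
    using ev xF l by blast
  show "\<exists>w\<in>rel_interior F. r *\<^sub>R w - A *v w \<in> F" if "r > face_radius A F"
  proof -
    have "eventually (\<lambda>n. (L \<circ> s) n < r) sequentially"
      using order_tendstoD(2)[OF Ls] that l by blast
    then obtain n where n: "L n < r"
      by (auto simp: eventually_sequentially)
    have "(r - L n) *\<^sub>R X n + e n *\<^sub>R g \<in> F"
      using n XF gF e_pos[of n] by (intro convex_cone_add[OF F(2)] convex_cone_scaleR[OF F(2)]) auto
    also have "(r - L n) *\<^sub>R X n + e n *\<^sub>R g = r *\<^sub>R X n - A *v X n"
      using XL(4)[of n] by (simp add: algebra_simps)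
    finally show ?thesis
      using XL(1) by blast
  qed
qed

section \<open>Invariant faces generated by eigenvectors and the implications between the
  conditions\<close>

text \<open>A preserves the order of K, so y \<le> \<alpha> x gives A y \<le> \<alpha> \<mu> x,
  again a multiple of x.\<close>

lemma invariant_face_gen_eigenvector:
  fixes A :: "real^'n^'n"
  assumes K: "proper_cone K" and A: "A \<in> cone_preserving K"
    and x: "x \<in> K" "eigenvector A \<mu> x"
  shows "invariant_face K A (face_gen K {x})"
proof -
  have cK: "convex_cone K" "K \<inter> uminus ` K = {0}" and AK: "\<And>y. y \<in> K \<Longrightarrow> A *v y \<in> K"
    using K A by (auto simp: proper_cone_def cone_preserving_def)
  have G: "cone_face K (face_gen K {x})" "x \<in> face_gen K {x}"
    using face_gen_least[OF cK(1), of "{x}"] x by auto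
  moreover have "A *v y \<in> face_gen K {x}" if y: "y \<in> face_gen K {x}" for y
  proof -
    obtain \<alpha> where h: "y \<in> K" "\<alpha> > 0" "\<alpha> *\<^sub>R x - y \<in> K"
      using y[unfolded face_gen_singleton[OF cK(1) x(1)]] by blast
    have "A *v (\<alpha> *\<^sub>R x - y) \<in> K" and Ay: "A *v y \<in> K"
      using AK h by auto
    then have d: "(\<alpha> * \<mu>) *\<^sub>R x - A *v y \<in> K"
      using x(2)
      by (simp add: eigenvector_def matrix_vector_mult_diff_distrib matrix_vector_mult_scaleR)
    show ?thesis
    proof (cases "\<mu> > 0")
      case True
      then show ?thesis
        using d Ay h face_gen_singleton[OF cK(1) x(1)]
        by (auto intro!: exI[of _ "\<alpha> * \<mu>"])
    next
      case False
      \<comment> \<open>For \<mu> \<le> 0 the factor \<alpha> \<mu> is not admissible as a witness;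
        here A y \<le> \<alpha> \<mu> x \<le> 0 forces A y = 0.\<close>
      have "(\<alpha> * - \<mu>) *\<^sub>R x \<in> K"
        using False h x(1) by (intro convex_cone_scaleR[OF cK(1)]) (auto simp: mult_nonneg_nonpos)
      from convex_cone_add[OF cK(1) d this] have "- (A *v y) \<in> K"
        by simp
      then have "A *v y = 0"
        using pointedD[OF cK(2) Ay] by blast
      then show ?thesis
        using G convex_cone_contains_0 by (auto simp: cone_face_def)
    qed
  qed
  ultimately show ?thesis
    unfolding invariant_face_def by auto
qed

lemma shifted_matrix_vector_mult: "(\<mu> *\<^sub>R mat 1 - A) *v v = \<mu> *\<^sub>R v - A *v (v::real^'n)"
  by (simp add: matrix_vector_mult_diff_rdistrib flip: scaleR_matrix_vector_assoc)

context
  fixes K :: "(real^'n) set" and A :: "real^'n^'n"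
  assumes K: "proper_cone K" and A: "A \<in> cone_preserving K"
begin

private lemma cK: "closed K" "convex_cone K" "K \<inter> uminus ` K = {0}"
  using K by (auto simp: proper_cone_def)

private lemma invariant_faceD:
  assumes "invariant_face K A G"
  shows "cone_face K G" "closed G" "convex_cone G" "G \<inter> uminus ` G = {0}" "(*v) A ` G \<subseteq> G" "G \<subseteq> K"
proof -
  show G: "cone_face K G" and "(*v) A ` G \<subseteq> G"
    using assms by (simp_all add: invariant_face_def)
  show "closed G" "G \<inter> uminus ` G = {0}"
    using cone_face_closed[OF cK(1,2) G] cone_face_pointed[OF cK(3) G] by simp_all
  show "convex_cone G" "G \<subseteq> K"
    using G by (simp_all add: cone_face_def)
qed

text \<open>All Perron eigenvectors of F lie in its relative interior. The exit point x - t y of the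
  ray does not, yet satisfies the same eigenvalue equation, so it must be 0.\<close>

lemma distinguished_imp_unique_eigenvector:
  assumes "distinguished_invariant_face K A F"
  shows "\<exists>x\<in>F. eigenvector A (face_radius A F) x \<and> x \<in> rel_interior F \<and>
           (\<forall>y\<in>F. eigenvector A (face_radius A F) y \<longrightarrow> (\<exists>c>0. y = c *\<^sub>R x))"
proof -
  let ?\<rho> = "face_radius A F"
  have iF: "invariant_face K A F" and F0: "F \<noteq> {0}"
    and lt: "\<And>G. invariant_face K A G \<Longrightarrow> G \<noteq> {0} \<Longrightarrow> G \<subset> F \<Longrightarrow> face_radius A G < ?\<rho>"
    using assms by (auto simp: distinguished_invariant_face_def)
  note F = invariant_faceD[OF iF]
  have rel: "x \<in> rel_interior F" if x: "x \<in> F" "eigenvector A ?\<rho> x" for x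
  proof -
    let ?G = "face_gen K {x}"
    have xK: "x \<in> K"
      using x F by auto
    have iG: "invariant_face K A ?G"
      using invariant_face_gen_eigenvector[OF K A xK x(2)] .
    have xG: "x \<in> ?G" and GF: "?G \<subseteq> F"
      using face_gen_least[OF cK(2), of "{x}"] x F xK by auto
    have "?\<rho> \<le> face_radius A ?G"
      using eigenvalue_le_face_radius[OF x(2) xG] by simp
    moreover have "?G \<noteq> {0}"
      using xG x by (auto simp: eigenvector_def)
    ultimately have "?G = F"
      using lt[OF iG] GF by fastforce
    then show ?thesis
      using rel_interior_face_gen_singleton[OF cK(2) xK] by simp
  qed
  obtain x where x: "x \<in> F" "eigenvector A ?\<rho> x"
    using perron_frobenius(1)[OF F(2,3,4) F0 F(5)] by blast
  have "\<exists>c>0. y = c *\<^sub>R x" if y: "y \<in> F" "eigenvector A ?\<rho> y" for y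
  proof -
    obtain t where t: "t \<ge> 0" "x - t *\<^sub>R y \<in> F" "x - t *\<^sub>R y \<notin> rel_interior F"
      using ray_exit[OF F(2,3,4) x(1) y(1)] y by (auto simp: eigenvector_def)
    have "A *v (x - t *\<^sub>R y) = ?\<rho> *\<^sub>R (x - t *\<^sub>R y)"
      using x y
      by (simp add: eigenvector_def matrix_vector_mult_diff_distrib matrix_vector_mult_scaleR
          algebra_simps)
    then have "x - t *\<^sub>R y = 0"
      using rel[OF t(2)] t(3) by (auto simp: eigenvector_def)
    then have xt: "x = t *\<^sub>R y"
      by simp
    moreover have "t \<noteq> 0"
      using xt x by (auto simp: eigenvector_def)
    ultimately show ?thesis
      using t(1) by (intro exI[of _ "1 / t"]) auto
  qed
  then show ?thesis
    using x rel by blast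
qed

text \<open>If two vectors of the null space in K add up to a multiple of x, the face property of F
  puts both into F, where uniqueness makes them multiples of x.\<close>

lemma unique_eigenvector_imp_extremal:
  assumes iF: "invariant_face K A F"
    and x: "eigenvector A \<mu> x" "x \<in> rel_interior F"
    and uniq: "\<And>y. y \<in> F \<Longrightarrow> eigenvector A \<mu> y \<Longrightarrow> \<exists>c>0. y = c *\<^sub>R x"
  shows "extremal_distinguished_eigenvector K A \<mu> x"
proof -
  note F = invariant_faceD[OF iF]
  let ?N = "{v. (\<mu> *\<^sub>R mat 1 - A) *v v = 0}" and ?R = "{c *\<^sub>R x | c. 0 \<le> c}"
  have N: "v \<in> ?N \<longleftrightarrow> A *v v = \<mu> *\<^sub>R v" for v
    unfolding mem_Collect_eq shifted_matrix_vector_mult right_minus_eq by (rule eq_commute)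
  have xF: "x \<in> F"
    using x rel_interior_subset by blast
  have R: "y \<in> ?R" if "y \<in> ?N" "y \<in> F" for y
  proof (cases "y = 0")
    case True
    then show ?thesis
      by (auto intro!: exI[of _ 0])
  next
    case False
    then show ?thesis
      using uniq[of y] that N by (force simp: eigenvector_def)
  qed
  have RF: "?R \<subseteq> F"
    using xF convex_cone_scaleR[OF F(3)] by auto
  have xN: "A *v x = \<mu> *\<^sub>R x" "x \<noteq> 0"
    using x by (auto simp: eigenvector_def)
  have "convex_cone ?R"
    unfolding convex_cone_iff
  proof (intro conjI ballI allI impI)
    show "0 \<in> ?R"
      by (auto intro!: exI[of _ 0])
    show "y + z \<in> ?R" if yz: "y \<in> ?R" "z \<in> ?R" for y z
    proof -
      obtain b c where "y = b *\<^sub>R x" "z = c *\<^sub>R x" "0 \<le> b" "0 \<le> c"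
        using yz by blast
      then show ?thesis
        by (auto simp flip: scaleR_add_left intro!: exI[of _ "b + c"])
    qed
    show "d *\<^sub>R y \<in> ?R" if y: "y \<in> ?R" "0 \<le> d" for y d
    proof -
      obtain c where "y = c *\<^sub>R x" "0 \<le> c"
        using y by blast
      then show ?thesis
        using y(2) by (auto intro!: exI[of _ "d * c"])
    qed
  qed
  moreover have "?R \<subseteq> ?N \<inter> K"
    using RF F(6) N xN by (auto simp: matrix_vector_mult_scaleR)
  moreover have "y \<in> ?R \<and> z \<in> ?R" if "y \<in> ?N \<inter> K" "z \<in> ?N \<inter> K" "y + z \<in> ?R" for y z
  proof -
    have "y \<in> F" "z \<in> F"
      using that RF F(1) unfolding cone_face_def by blast+
    then show ?thesis
      using R that by blast
  qed
  ultimately have "cone_face (?N \<inter> K) ?R"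
    unfolding cone_face_def by blast
  then show ?thesis
    using xF F(6) N xN
    by (auto simp: extremal_distinguished_eigenvector_def extreme_vector_def)
qed

text \<open>A proper subface G with radius \<mu> would contain an eigenvector y for \<mu>. As x
  dominates y, some \<alpha> x splits into y and \<alpha> x - y within the eigencone; extremality
  puts y on the ray of x, so x lies in G and G is not proper.\<close>

lemma extremal_imp_distinguished:
  assumes ext: "extremal_distinguished_eigenvector K A \<mu> x"
  shows "distinguished_invariant_face K A (face_gen K {x})"
proof -
  let ?N = "{v. (\<mu> *\<^sub>R mat 1 - A) *v v = 0}" and ?R = "{c *\<^sub>R x | c. 0 \<le> c}"
    and ?F = "face_gen K {x}"
  have N: "v \<in> ?N \<longleftrightarrow> A *v v = \<mu> *\<^sub>R v" for v
    unfolding mem_Collect_eq shifted_matrix_vector_mult right_minus_eq by (rule eq_commute)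
  have "x \<in> ?N \<inter> K" "x \<noteq> 0" and face: "cone_face (?N \<inter> K) ?R"
    using ext by (auto simp: extremal_distinguished_eigenvector_def extreme_vector_def)
  then have x: "eigenvector A \<mu> x" "x \<in> K"
    using N by (auto simp: eigenvector_def)
  have iF: "invariant_face K A ?F"
    using invariant_face_gen_eigenvector[OF K A x(2,1)] .
  note F = invariant_faceD[OF iF]
  have rx: "x \<in> rel_interior ?F"
    using rel_interior_face_gen_singleton[OF cK(2) x(2)] .
  then have xF: "x \<in> ?F"
    using rel_interior_subset by blast
  have rho: "face_radius A ?F = \<mu>"
    using face_radius_eigenvector[OF F(2-5) rx x(1)] .
  have "face_radius A G < \<mu>" if G: "invariant_face K A G" "G \<noteq> {0}" "G \<subset> ?F" for G
  proof -
    note G' = invariant_faceD[OF G(1)]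
    obtain y where y: "y \<in> G" "eigenvector A (face_radius A G) y"
      using perron_frobenius(1)[OF G'(2-4) G(2) G'(5)] by blast
    have "face_radius A G \<le> \<mu>"
      using eigenvalue_le_face_radius[OF y(2), of ?F] y(1) G(3) rho by auto
    moreover have "face_radius A G \<noteq> \<mu>"
    proof
      assume eq: "face_radius A G = \<mu>"
      obtain \<alpha> where al: "\<alpha> > 0" "\<alpha> *\<^sub>R x - y \<in> ?F"
        using rx cone_rel_interior_iff[OF F(3)] y(1) G(3) by blast
      have "y \<in> ?N \<inter> K"
        using y eq N G'(6) by (auto simp: eigenvector_def)
      moreover have "\<alpha> *\<^sub>R x - y \<in> ?N \<inter> K"
        using y eq x al F(6) N
        by (auto simp: eigenvector_def matrix_vector_mult_diff_distrib matrix_vector_mult_scaleR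
            algebra_simps)
      moreover have "y + (\<alpha> *\<^sub>R x - y) \<in> ?R"
        using al by auto
      ultimately have "y \<in> ?R"
        using face unfolding cone_face_def by blast
      then obtain c where c: "c \<ge> 0" "y = c *\<^sub>R x"
        by blast
      then have "c > 0"
        using y by (cases "c = 0") (auto simp: eigenvector_def)
      then have "x \<in> G"
        using cone_face_mem_of_scaleR[OF G'(1)] c y(1) by blast
      then have "?F \<subseteq> G"
        using face_gen_least(3)[OF cK(2), of "{x}" G] x(2) G'(1) by auto
      then show False
        using G(3) by blast
    qed
    ultimately show ?thesis
      by simp
  qed
  moreover have "?F \<noteq> {0}"
    using xF x(1) by (auto simp: eigenvector_def)
  ultimately show ?thesis
    using iF rho by (auto simp: distinguished_invariant_face_def)
qed

text \<open>If F were a join of two proper invariant faces, an r between their radii and that of F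
  would admit supersolutions u and v in the two relative interiors. Then u + v is one for F,
  contradicting r < \<rho>.\<close>

lemma distinguished_imp_join_irreducible:
  assumes "distinguished_invariant_face K A F"
  shows "invariant_join_irreducible K A F"
proof -
  let ?\<rho> = "face_radius A F"
  have iF: "invariant_face K A F" and F0: "F \<noteq> {0}"
    and lt: "\<And>G. invariant_face K A G \<Longrightarrow> G \<noteq> {0} \<Longrightarrow> G \<subset> F \<Longrightarrow> face_radius A G < ?\<rho>"
    using assms by (auto simp: distinguished_invariant_face_def)
  note F = invariant_faceD[OF iF]
  have False if GH: "invariant_face K A G" "invariant_face K A H" "G \<subset> F" "H \<subset> F"
    "F = face_join K G H" for G H
  proof -
    note G = invariant_faceD[OF GH(1)] and H = invariant_faceD[OF GH(2)]
    have min: "F \<subseteq> J" if "cone_face K J" "G \<subseteq> J" "H \<subseteq> J" for J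
      using face_gen_least(3)[OF cK(2), of "G \<union> H" J] that G(6) H(6) GH(5)
      by (auto simp: face_join_def)
    \<comment> \<open>A zero face contributes nothing: the join would be the other, proper face.
      This must be excluded since distinguishedness compares only nonzero subfaces.\<close>
    have "G \<noteq> {0}"
      using min[of H] H(1) convex_cone_contains_0[OF H(3)] GH(4) by blast
    moreover have "H \<noteq> {0}"
      using min[of G] G(1) convex_cone_contains_0[OF G(3)] GH(3) by blast
    moreover note lt[OF GH(1)] lt[OF GH(2)]
    ultimately have less: "max (face_radius A G) (face_radius A H) < ?\<rho>"
      and GH0: "G \<noteq> {0}" "H \<noteq> {0}"
      using GH by auto
    then obtain r where r: "max (face_radius A G) (face_radius A H) < r" "r < ?\<rho>"
      using dense by blast
    obtain u where u: "u \<in> rel_interior G" "r *\<^sub>R u - A *v u \<in> G"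
      using perron_frobenius(2)[OF G(2-4) GH0(1) G(5), of r] r by auto
    obtain v where v: "v \<in> rel_interior H" "r *\<^sub>R v - A *v v \<in> H"
      using perron_frobenius(2)[OF H(2-4) GH0(2) H(5), of r] r by auto
    have uv: "u \<in> K" "v \<in> K" "u \<in> F" "v \<in> F"
      using u v G(6) H(6) GH(3,4) rel_interior_subset by blast+
    have uvK: "u + v \<in> K"
      using uv convex_cone_add[OF cK(2)] by blast
    \<comment> \<open>A face containing u + v contains both summands, hence \<Phi>(u) = G and
      \<Phi>(v) = H, hence their join.\<close>
    have "u + v \<in> rel_interior F"
    proof -
      let ?J = "face_gen K {u + v}"
      have J: "cone_face K ?J" "u + v \<in> ?J"
        using face_gen_least[OF cK(2), of "{u + v}"] uvK by auto
      then have "u \<in> ?J" "v \<in> ?J"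
        using uv unfolding cone_face_def by blast+
      then have "face_gen K {u} \<subseteq> ?J" "face_gen K {v} \<subseteq> ?J"
        using face_gen_least(3)[OF cK(2) _ J(1)] uv by auto
      then have "F \<subseteq> ?J"
        using min[OF J(1)] face_gen_rel_interior[OF cK(2) G(1) u(1)]
          face_gen_rel_interior[OF cK(2) H(1) v(1)] by simp
      moreover have "?J \<subseteq> F"
        using face_gen_least(3)[OF cK(2), of "{u + v}" F] uvK F(1) convex_cone_add[OF F(3) uv(3,4)]
        by auto
      ultimately show ?thesis
        using rel_interior_face_gen_singleton[OF cK(2) uvK] by simp
    qed
    moreover have "r *\<^sub>R (u + v) - A *v (u + v) \<in> F"
    proof -
      have "(r *\<^sub>R u - A *v u) + (r *\<^sub>R v - A *v v) \<in> F"
        using u v GH(3,4) by (intro convex_cone_add[OF F(3)]) auto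
      then show ?thesis
        by (simp add: matrix_vector_right_distrib algebra_simps)
    qed
    moreover have "0 \<le> r"
    proof -
      have "0 \<le> face_radius A G"
        using spectral_radius_on_le_iff[of A "span G" "face_radius A G"]
        by (simp add: face_radius_def)
      then show ?thesis
        using r by simp
    qed
    ultimately have "?\<rho> \<le> r"
      by (rule face_radius_le[OF F(2-5)])
    then show False
      using r by simp
  qed
  then show ?thesis
    using iF by (auto simp: invariant_join_irreducible_def)
qed

text \<open>A second eigenvector \<open>y\<close> would let the line through \<open>x\<close> and \<open>y\<close> leave \<open>F\<close> at boundary
  eigenvectors \<open>u = x - t y\<close> and \<open>v = y - s x\<close>; since \<open>u + t v\<close> is a positive multiple of \<open>x\<close>,
  \<open>F\<close> would be the join of \<open>\<Phi>(u)\<close> and \<open>\<Phi>(v)\<close>.\<close>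

lemma join_irreducible_imp_unique_eigenvector:
  assumes irr: "invariant_join_irreducible K A F"
    and x: "x \<in> rel_interior F" "eigenvector A \<mu> x"
    and y: "y \<in> F" "eigenvector A \<mu> y"
  shows "\<exists>c>0. y = c *\<^sub>R x"
proof -
  have iF: "invariant_face K A F"
    using irr by (simp add: invariant_join_irreducible_def)
  note F = invariant_faceD[OF iF]
  have xF: "x \<in> F"
    using x rel_interior_subset by blast
  have x0: "x \<noteq> 0" and y0: "y \<noteq> 0"
    using x y by (auto simp: eigenvector_def)
  obtain t where t: "t \<ge> 0" "x - t *\<^sub>R y \<in> F" "x - t *\<^sub>R y \<notin> rel_interior F"
    using ray_exit[OF F(2,3,4) xF y(1) y0] by blast
  obtain s where s: "s \<ge> 0" "y - s *\<^sub>R x \<in> F" "y - s *\<^sub>R x \<notin> rel_interior F"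
    using ray_exit[OF F(2,3,4) y(1) xF x0] by blast
  define u v where "u = x - t *\<^sub>R y" and "v = y - s *\<^sub>R x"
  have uv: "u \<in> F" "v \<in> F" "u \<notin> rel_interior F" "v \<notin> rel_interior F" "u \<in> K" "v \<in> K"
    using t s F(6) by (auto simp: u_def v_def)
  have "A *v u = \<mu> *\<^sub>R u" "A *v v = \<mu> *\<^sub>R v"
    using x y
    by (simp_all add: u_def v_def eigenvector_def matrix_vector_mult_diff_distrib
        matrix_vector_mult_scaleR algebra_simps)
  then have ev: "u \<noteq> 0 \<Longrightarrow> eigenvector A \<mu> u" "v \<noteq> 0 \<Longrightarrow> eigenvector A \<mu> v"
    by (auto simp: eigenvector_def)
  consider "u = 0" | "v = 0" | "u \<noteq> 0" "v \<noteq> 0"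
    by blast
  then show ?thesis
  proof cases
    case 1
    then have xt: "x = t *\<^sub>R y"
      by (simp add: u_def)
    then have "t \<noteq> 0"
      using x0 by auto
    then show ?thesis
      using t(1) xt by (intro exI[of _ "1 / t"]) auto
  next
    case 2
    then have ys: "y = s *\<^sub>R x"
      by (simp add: v_def)
    then have "s \<noteq> 0"
      using y0 by auto
    then show ?thesis
      using s(1) ys by (intro exI[of _ s]) auto
  next
    case 3
    have sum: "u + t *\<^sub>R v = (1 - t * s) *\<^sub>R x"
      by (simp add: u_def v_def algebra_simps)
    have tv: "t *\<^sub>R v \<in> F"
      using t(1) uv by (intro convex_cone_scaleR[OF F(3)])
    \<comment> \<open>Otherwise u + t v and its negative both lie in F, and pointedness forces first
      the sum and then u to vanish.\<close>
    have pos: "1 - t * s > 0"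
    proof (rule ccontr)
      assume "\<not> 1 - t * s > 0"
      then have "(t * s - 1) *\<^sub>R x \<in> F"
        using xF by (intro convex_cone_scaleR[OF F(3)]) auto
      also have "(t * s - 1) *\<^sub>R x = - (u + t *\<^sub>R v)"
        by (simp add: sum algebra_simps)
      finally have "u + t *\<^sub>R v = 0"
        using pointedD[OF F(4) convex_cone_add[OF F(3) uv(1) tv]] by blast
      then have "- u = t *\<^sub>R v"
        by (simp add: minus_unique)
      then have "u = 0"
        using pointedD[OF F(4) uv(1)] tv by simp
      then show False
        using 3 by blast
    qed
    let ?G = "face_gen K {u}" and ?H = "face_gen K {v}"
    have iGH: "invariant_face K A ?G" "invariant_face K A ?H"
      using invariant_face_gen_eigenvector[OF K A] uv ev 3 by blast+
    \<comment> \<open>Properness: u and v are relative interior in the faces they generate but not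
      in F.\<close>
    have GF: "?G \<subset> F" "?H \<subset> F"
      using face_gen_least(3)[OF cK(2) _ F(1)] uv rel_interior_face_gen_singleton[OF cK(2)]
      by (metis empty_subsetI insert_subset psubsetI)+
    let ?J = "face_join K ?G ?H"
    have sub: "?G \<union> ?H \<subseteq> K"
      using GF F(6) by blast
    have J: "cone_face K ?J" "?G \<union> ?H \<subseteq> ?J" "?J \<subseteq> F"
      using face_gen_least[OF cK(2) sub] F(1) GF by (auto simp: face_join_def)
    have "u \<in> ?J" "v \<in> ?J"
      using J(2) face_gen_least(2)[OF cK(2)] uv by blast+
    then have "u + t *\<^sub>R v \<in> ?J"
      using J(1) t(1) by (auto simp: cone_face_def intro!: convex_cone_add convex_cone_scaleR)
    then have "x \<in> ?J"
      using cone_face_mem_of_scaleR[OF J(1) pos] sum by simp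
    then have "F \<subseteq> ?J"
      using face_gen_least(3)[OF cK(2) _ J(1), of "{x}"] face_gen_rel_interior[OF cK(2) F(1) x(1)]
        xF F(6) by auto
    then have "F = ?J"
      using J(3) by blast
    then show ?thesis
      using irr iGH GF unfolding invariant_join_irreducible_def by blast
  qed
qed

end

theorem theorem4p11:
  fixes K F :: "(real^'n) set" and A :: "real^'n^'n"
  assumes "proper_cone K"
    and "A \<in> cone_preserving K"
    and "cone_face K F"
  shows
    "(distinguished_invariant_face K A F \<longleftrightarrow>
        invariant_face K A F \<and>
        (\<exists>x\<in>F. eigenvector A (face_radius A F) x \<and> x \<in> rel_interior F \<and>
           (\<forall>y\<in>F. eigenvector A (face_radius A F) y \<longrightarrow> (\<exists>c>0. y = c *\<^sub>R x)))) \<and>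
     (distinguished_invariant_face K A F \<longleftrightarrow>
        (\<exists>\<mu> x. extremal_distinguished_eigenvector K A \<mu> x \<and> F = face_gen K {x})) \<and>
     (distinguished_invariant_face K A F \<longleftrightarrow>
        invariant_join_irreducible K A F \<and>
        (\<exists>\<mu>. \<exists>x \<in> rel_interior F. eigenvector A \<mu> x))"
    (is "(?a \<longleftrightarrow> ?b) \<and> (?a \<longleftrightarrow> ?c) \<and> (?a \<longleftrightarrow> ?d)")
proof -
  note KA = assms(1,2)
  have cK: "closed K" "convex_cone K" "K \<inter> uminus ` K = {0}"
    using assms(1) by (auto simp: proper_cone_def)
  \<comment> \<open>The implications form two cycles, (a) to (b) to (c) to (a) and (a) to (d) to
    (b), so (d) returns to (a) through (b).\<close>
  have ab: ?b if ?a
    using that distinguished_imp_unique_eigenvector[OF KA]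
    by (auto simp: distinguished_invariant_face_def)
  have bc: ?c if ?b
    using that unique_eigenvector_imp_extremal[OF KA, of F "face_radius A F"]
      face_gen_rel_interior[OF cK(2) assms(3)] by metis
  have ca: ?a if ?c
    using that extremal_imp_distinguished[OF KA] by blast
  have ad: ?d if ?a
    using ab[OF that] distinguished_imp_join_irreducible[OF KA that] by blast
  have db: ?b if d: ?d
  proof -
    have iF: "invariant_face K A F"
      using d by (simp add: invariant_join_irreducible_def)
    obtain \<mu> x where x: "x \<in> rel_interior F" "eigenvector A \<mu> x"
      using d by blast
    \<comment> \<open>Condition (d) leaves the eigenvalue open; the position of x in the relative
      interior identifies it with the radius that (b) asks for.\<close>
    have "face_radius A F = \<mu>"
      using face_radius_eigenvector[OF _ _ _ _ x] iF cone_face_closed[OF cK(1,2) assms(3)]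
        cone_face_pointed[OF cK(3) assms(3)] assms(3)
      by (simp add: invariant_face_def cone_face_def)
    then show ?thesis
      using iF x join_irreducible_imp_unique_eigenvector[OF KA _ x] d rel_interior_subset
      by blast
  qed
  show ?thesis
    using ab bc ca ad db by blast
qed

end
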